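(* For every $n\ge 1$, $$pre_2(n)\ \ge\ \begin{cases}\dfrac{\tau(n+1)}{2}, & \text{if } n+1 \text{ is not a perfect square},\\[2mm] \dfrac{\tau(n+1)+1}{2}, & \text{if } n+1 \text{ is a perfect square},\end{cases}$$ where $\tau(m)$ denotes the number of positive divisors of $m$.
   Context: A partition $\lambda=(\lambda_1,\dots,\lambda_\ell)$ of $n$ is a non-increasing sequence of positive integers summing to $n$. The map $pre_2$ sends a partition $\lambda$ with $\ell\ge 2$ parts to the partition whose multiset of parts is $\{\lambda_i\lambda_j : 1\le i<j\le \ell\}$ (and sends partitions with fewer than two parts to the empty partition). $pre_2(n)$ denotes the number of partitions of $n$ that lie in the image of the map $pre_2$ (i.e. partitions $\nu$ of $n$ for which there exists a partition $\lambda$, of any integer, with $pre_2(\lambda)=\nu$). *)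

theory Defs
  imports Complex_Main "HOL-Library.Multiset" "HOL-Computational_Algebra.Nth_Powers"
begin

definition is_partition :: "nat list \<Rightarrow> bool" where
  "is_partition xs \<longleftrightarrow> sorted_wrt (\<ge>) xs \<and> (\<forall>x\<in>set xs. x > 0)"

definition partition_of :: "nat \<Rightarrow> nat list \<Rightarrow> bool" where
  "partition_of n xs \<longleftrightarrow> is_partition xs \<and> sum_list xs = n"

(* Indices run over 0 <= i < j < length xs instead of 1 <= i < j <= l. *)
definition pre2_parts :: "nat list \<Rightarrow> nat multiset" where
  "pre2_parts xs = image_mset (\<lambda>(i, j). xs ! i * xs ! j) (mset_set {(i, j). i < j \<and> j < length xs})"

definition pre2 :: "nat list \<Rightarrow> nat list" where
  "pre2 xs = (if length xs < 2 then [] else rev (sorted_list_of_multiset (pre2_parts xs)))"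

definition pre2_count :: "nat \<Rightarrow> nat" where
  "pre2_count n = card {ys. partition_of n ys \<and> (\<exists>xs. is_partition xs \<and> pre2 xs = ys)}"

definition divisor_count :: "nat \<Rightarrow> nat" where
  "divisor_count m = card {d. d dvd m}"

lemma finite_pre2_index: "finite {(i, j). i < j \<and> j < (l::nat)}"
  by (rule finite_subset[of _ "{..<l} \<times> {..<l}"]) auto

lemma mset_pre2: "length xs \<ge> 2 \<Longrightarrow> mset (pre2 xs) = pre2_parts xs"
  by (simp add: pre2_def)

lemma is_partition_pre2:
  assumes "is_partition xs"
  shows "is_partition (pre2 xs)"
proof -
  have "0 < y" if "y \<in># pre2_parts xs" for y
    using that assms finite_pre2_index[of "length xs"]
    by (force simp: pre2_parts_def is_partition_def)
  moreover have "sorted_wrt (\<ge>) (rev (sorted_list_of_multiset (pre2_parts xs)))"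
    using sorted_sorted_list_of_multiset[of "pre2_parts xs"]
    by (simp add: sorted_wrt_rev)
  ultimately show ?thesis
    by (auto simp: pre2_def is_partition_def)
qed

(* Since card is 0 on infinite sets, this is needed for pre2_count to be a genuine count. *)
lemma finite_partitions: "finite {ys. partition_of n ys}"
proof (rule finite_subset)
  show "{ys. partition_of n ys} \<subseteq> {ys. set ys \<subseteq> {..n} \<and> length ys \<le> n}"
  proof clarify
    fix ys assume p: "partition_of n ys"
    have "length zs \<le> sum_list zs" if "\<forall>z\<in>set zs. z > 0" for zs :: "nat list"
      using that by (induction zs) auto
    with p have "length ys \<le> n" by (auto simp: partition_of_def is_partition_def)
    moreover have "set ys \<subseteq> {..n}"
      using p member_le_sum_list by (auto simp: partition_of_def)
    ultimately show "set ys \<subseteq> {..n} \<and> length ys \<le> n" by blast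
  qed
qed (use finite_lists_length_le[of "{..n}"] in auto)

end

theory Submission
  imports Defs
begin

text \<open>
  Taking \<open>\<lambda> = (b, a, 1)\<close> gives the parts \<open>ab, b, a\<close>, whose sum is \<open>(a + 1)(b + 1) - 1\<close>. So every
  factorisation \<open>n + 1 = d e\<close> with \<open>2 \<le> d \<le> e\<close> yields a partition of \<open>n\<close> in the image, with
  smallest part \<open>d - 1\<close>, while \<open>d = 1\<close> is accounted for by \<open>\<lambda> = (n, 1)\<close>, with image \<open>(n)\<close>. The
  partitions are distinct for distinct \<open>d\<close>, and the divisors \<open>d\<close> of \<open>n + 1\<close> with
  \<open>d\<^sup>2 \<le> n + 1\<close> are half of all divisors, the square root counting for the smaller half.
\<close>

text \<open>A non-increasing list is determined by its multiset, so an image under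
  \<open>pre2\<close> can be identified from its parts alone.\<close>

lemma pre2_eqI:
  assumes "length xs \<ge> 2" "sorted_wrt (\<ge>) ys" "pre2_parts xs = mset ys"
  shows "pre2 xs = ys"
proof -
  have "sort (rev ys) = rev ys"
    using assms(2) by (simp add: sorted_sort_id sorted_wrt_rev)
  moreover have "sort ys = sort (rev ys)"
    by (rule properties_for_sort) simp_all
  ultimately show ?thesis
    using assms(1,3) by (simp add: pre2_def)
qed

lemma pre2_pair: "pre2 [x, y] = [x * y]"
proof (rule pre2_eqI)
  have "{(i, j). i < j \<and> j < length [x, y]} = {(0, 1)}"
    by (auto simp: less_Suc_eq)
  then show "pre2_parts [x, y] = mset [x * y]"
    unfolding pre2_parts_def by simp
qed simp_all

lemma pre2_triple:
  assumes "x \<ge> y" "y \<ge> z"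
  shows "pre2 [x, y, z] = [x * y, x * z, y * z]"
proof (rule pre2_eqI)
  have "{(i, j). i < j \<and> j < length [x, y, z]} = {(0, 1), (0, 2), (1, 2)}"
    by (auto simp: less_Suc_eq numeral_2_eq_2)
  then show "pre2_parts [x, y, z] = mset [x * y, x * z, y * z]"
    unfolding pre2_parts_def by simp
  show "sorted_wrt (\<ge>) [x * y, x * z, y * z]"
    using assms by (simp add: mult_le_mono)
qed simp

text \<open>Passing to the cofactor pairs each divisor above the square root of \<open>m\<close>
  with one strictly below it. The root itself, if integral, lies in \<open>D\<close> but not in
  \<open>S\<close>, which accounts for the extra 1.\<close>

lemma divisor_count_le:
  fixes m :: nat
  assumes "m > 0"
  shows "divisor_count m + (if is_square m then 1 else 0) \<le> 2 * card {d. d dvd m \<and> d * d \<le> m}"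
proof -
  define D where "D = {d. d dvd m \<and> d * d \<le> m}"
  define S where "S = {d. d dvd m \<and> d * d < m}"
  have fin: "finite D"
    unfolding D_def by (rule finite_subset[OF _ finite_divisors_nat[OF assms]]) auto
  have "S \<subseteq> D" by (auto simp: S_def D_def)
  with fin have finS: "finite S" by (rule finite_subset[rotated])
  have "{d. d dvd m} \<subseteq> D \<union> (\<lambda>d. m div d) ` S"
  proof
    fix d assume "d \<in> {d. d dvd m}"
    then obtain e where e: "m = d * e" by blast
    show "d \<in> D \<union> (\<lambda>d. m div d) ` S"
    proof (cases "d \<le> e")
      case True
      with e show ?thesis by (simp add: D_def)
    next
      case False
      \<comment> \<open>Here \<open>e < d\<close>, and \<open>e > 0\<close> because
        \<open>m > 0\<close>; hence \<open>e * e < d * e = m\<close>.\<close>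
      with e assms have "e \<in> S" "d = m div e" by (simp_all add: S_def)
      then show ?thesis by blast
    qed
  qed
  then have "divisor_count m \<le> card (D \<union> (\<lambda>d. m div d) ` S)"
    unfolding divisor_count_def using fin finS by (intro card_mono) auto
  also have "\<dots> \<le> card D + card S"
    using card_Un_le card_image_le[OF finS] by (meson add_left_mono le_trans)
  finally have count: "divisor_count m \<le> card D + card S" .
  have "card S + (if is_square m then 1 else 0) \<le> card D"
  proof (cases "is_square m")
    case True
    then obtain r where "m = r\<^sup>2" by (elim is_nth_powerE)
    then have "r \<in> D - S" by (simp add: D_def S_def power2_eq_square)
    with \<open>S \<subseteq> D\<close> fin have "card S < card D" by (intro psubset_card_mono) auto
    then show ?thesis by simp
  next
    case False
    with \<open>S \<subseteq> D\<close> fin show ?thesis by (simp add: card_mono)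
  qed
  with count show ?thesis unfolding D_def by linarith
qed

lemma card_small_divisors_le_pre2_count:
  assumes "n \<ge> 1"
  shows "card {d. d dvd n + 1 \<and> d * d \<le> n + 1} \<le> pre2_count n"
proof -
  define D where "D = {d. d dvd n + 1 \<and> d * d \<le> n + 1}"
  define b where "b d = (n + 1) div d - 1" for d
  \<comment> \<open>\<open>b d\<close> is the cofactor of \<open>d\<close> minus 1. The case
    \<open>d = 1\<close> is separate because the triple would then contain zeros.\<close>
  define f where "f d = (if d = 1 then [n] else [b d * (d - 1), b d, d - 1])" for d
  define I where "I = {ys. partition_of n ys \<and> (\<exists>xs. is_partition xs \<and> pre2 xs = ys)}"
  \<comment> \<open>The length of \<open>f d\<close> singles out \<open>d = 1\<close>; otherwise the
    last entry \<open>d - 1\<close> recovers \<open>d\<close>.\<close>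
  have "inj_on f D"
  proof (rule inj_onI)
    fix c d assume "c \<in> D" "d \<in> D" "f c = f d"
    moreover from this have "c > 0" "d > 0"
      by (auto simp: D_def intro!: Nat.gr0I)
    ultimately show "c = d"
      by (auto simp: f_def split: if_splits)
  qed
  moreover have "f ` D \<subseteq> I"
  proof
    fix ys assume "ys \<in> f ` D"
    then obtain d where d: "d \<in> D" "ys = f d" by blast
    from d(1) obtain e where e: "n + 1 = d * e" "d * d \<le> d * e"
      unfolding D_def by (metis (no_types, lifting) dvdE mem_Collect_eq)
    show "ys \<in> I"
    proof (cases "d = 1")
      case True
      have "is_partition [n, 1]" "pre2 [n, 1] = ys" "partition_of n ys"
        using assms True d(2) by (simp_all add: is_partition_def partition_of_def pre2_pair f_def)
      then show ?thesis unfolding I_def by blast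
    next
      case False
      from e have "d \<noteq> 0" by (auto intro: Nat.gr0I)
      define a where "a = d - 1"
      from False \<open>d \<noteq> 0\<close> have a: "d = a + 1" "a \<ge> 1" by (simp_all add: a_def)
      \<comment> \<open>Cancelling \<open>d\<close> in \<open>d * d \<le> d * e\<close> gives
        \<open>d \<le> e\<close>, which puts \<open>[b d, a, 1]\<close> in non-increasing
        order.\<close>
      from e \<open>d \<noteq> 0\<close> have "d \<le> e" "b d = e - 1" by (simp_all add: b_def)
      with a have be: "e = b d + 1" "b d \<ge> a" by simp_all
      have lam: "is_partition [b d, a, 1]"
        using a be by (simp add: is_partition_def)
      have ys: "ys = [b d * a, b d, a]"
        using False by (simp add: d(2) f_def a_def)
      then have "pre2 [b d, a, 1] = ys"
        using pre2_triple[OF be(2) a(2)] by simp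
      have "n + 1 = (a + 1) * (b d + 1)"
        using e(1) a(1) be(1) by metis
      then have "sum_list ys = n"
        by (simp add: ys algebra_simps)
      with is_partition_pre2[OF lam] lam \<open>pre2 [b d, a, 1] = ys\<close> show ?thesis
        unfolding I_def partition_of_def by auto
    qed
  qed
  moreover have "finite I"
    unfolding I_def by (rule finite_subset[OF _ finite_partitions[of n]]) auto
  ultimately have "card D \<le> card I"
    by (rule card_inj_on_le)
  then show ?thesis
    by (simp add: D_def I_def pre2_count_def)
qed

theorem theorem1p7:
  fixes n :: nat
  assumes "n \<ge> 1"
  shows "real (pre2_count n) \<ge>
    (if is_square (n + 1) then (real (divisor_count (n + 1)) + 1) / 2
     else real (divisor_count (n + 1)) / 2)"
proof -
  \<comment> \<open>Doubling turns both cases into one inequality between naturals; the division by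
    2 then happens in the reals.\<close>
  have "divisor_count (n + 1) + (if is_square (n + 1) then 1 else 0) \<le> 2 * pre2_count n"
    using divisor_count_le[of "n + 1"] card_small_divisors_le_pre2_count[OF assms] by linarith
  then show ?thesis by (auto split: if_splits)
qed

end
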